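(* Let $m>n$, let $X\subset\mathbb{R}^m$ be open and bounded, let $Y\subset\mathbb{R}^n$ be a bounded domain, and let $b\in C^4(\overline X\times\overline Y)$. For $x\in X$, $y\in Y$ let $L_x(y)=\{\overline x\in X: D_yb(\overline x,y)=D_yb(x,y)\}$. Assume each $L_x(y)$ is connected and that $L_x(y)$ is independent of $y\in Y$ for every $x\in X$; write $L_x$ for it. Then for any $x_0,x_1\in X$ with $x_0\in L_{x_1}$, any $\overline y\in Y$, and any $b$-convex function $v^b$ (arising from a price schedule $v$), we have $v^b(x_0)=b(x_0,\overline y)-v(\overline y)$ if and only if $v^b(x_1)=b(x_1,\overline y)-v(\overline y)$.
   Context: A price schedule is a function $v:\overline Y\to\mathbb{R}\cup\{+\infty\}$; the associated $b$-convex utility function is $v^b(x)=\sup_{y\in\overline Y}(b(x,y)-v(y))$, assumed finite on $X$. $D_yb(x,y)\in\mathbb{R}^n$ is the gradient of $b$ in $y$. A domain is a nonempty connected open set. *)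

theory Defs
  imports "HOL-Analysis.Analysis"
begin

text \<open>
  Membership in \<open>C\<^sup>k\<close> of the closure of an open set \<open>U\<close>: all derivatives of order at most \<open>k\<close>
  exist on \<open>U\<close> and extend continuously to \<open>closure U\<close>. The gradient field \<open>G\<close> has to be the
  derivative of \<open>f\<close> on \<open>U\<close> only; on the frontier its values are those of the (unique)
  continuous extension.
\<close>

primrec C_closure :: "nat \<Rightarrow> 'a::euclidean_space set \<Rightarrow> ('a \<Rightarrow> real) \<Rightarrow> bool" where
  "C_closure 0 U f \<longleftrightarrow> continuous_on (closure U) f"
| "C_closure (Suc k) U f \<longleftrightarrow> continuous_on (closure U) f \<and>
     (\<exists>G. (\<forall>z\<in>U. GDERIV f z :> G z) \<and> (\<forall>i\<in>Basis. C_closure k U (\<lambda>z. G z \<bullet> i)))"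

text \<open>Unspecified where \<open>b x\<close> is not differentiable at \<open>y\<close>.\<close>

definition grad_y :: "('a \<Rightarrow> 'b::real_inner \<Rightarrow> real) \<Rightarrow> 'a \<Rightarrow> 'b \<Rightarrow> 'b" where
  "grad_y b x y = (THE D. GDERIV (b x) y :> D)"

definition level_set :: "('a \<Rightarrow> 'b::real_inner \<Rightarrow> real) \<Rightarrow> 'a set \<Rightarrow> 'a \<Rightarrow> 'b \<Rightarrow> 'a set" where
  "level_set b X x y = {x' \<in> X. grad_y b x' y = grad_y b x y}"

text \<open>
  Price schedules have values in \<open>\<real> \<union> {+\<infinity>}\<close>; they are total functions here, and only their
  values on \<open>closure Y\<close> matter.
\<close>

definition price_schedule :: "'b::topological_space set \<Rightarrow> ('b \<Rightarrow> ereal) \<Rightarrow> bool" where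
  "price_schedule Y v \<longleftrightarrow> (\<forall>y\<in>closure Y. v y \<noteq> -\<infinity>)"

definition b_utility ::
  "('a \<Rightarrow> 'b::topological_space \<Rightarrow> real) \<Rightarrow> 'b set \<Rightarrow> ('b \<Rightarrow> ereal) \<Rightarrow> 'a \<Rightarrow> ereal" where
  "b_utility b Y v x = (SUP y\<in>closure Y. ereal (b x y) - v y)"

end

theory Submission
  imports Defs
begin

text \<open>
  Points of the same level set have the same gradient in \<open>y\<close> everywhere on the connected set \<open>Y\<close>,
  so \<open>b x\<^sub>0\<close> and \<open>b x\<^sub>1\<close> differ by a constant on \<open>Y\<close>, and by continuity on \<open>closure Y\<close>. Adding a
  constant to \<open>b x\<close> shifts the utility at \<open>x\<close> by that constant and keeps the maximizers.
\<close>

text \<open>Makes the definite description in \<open>grad_y\<close> usable: the derivative is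
  unique, and a vector is determined by its inner products with all vectors.\<close>

lemma GDERIV_grad_y:
  assumes "GDERIV (b x) y :> D"
  shows "GDERIV (b x) y :> grad_y b x y"
proof -
  have "D' = D" if "GDERIV (b x) y :> D'" for D'
  proof -
    have "(\<lambda>h. h \<bullet> D') = (\<lambda>h. h \<bullet> D)"
      using that assms unfolding gderiv_def by (rule has_derivative_unique)
    then show ?thesis
      by (simp only: fun_eq_iff vector_eq_ldot)
  qed
  then show ?thesis
    unfolding grad_y_def by (rule theI[of "\<lambda>D. GDERIV (b x) y :> D", OF assms])
qed

text \<open>Chain rule along \<open>Pair x\<close>: its derivative sends \<open>h\<close> to
  \<open>(0, h)\<close>, and the inner product with \<open>D\<close> then sees only
  \<open>snd D\<close>.\<close>

lemma GDERIV_Pair_right: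
  assumes "GDERIV (\<lambda>(x, y). f x y) (x, y) :> D"
  shows "GDERIV (f x) y :> snd D"
proof -
  have "(Pair x has_derivative (\<lambda>h. (0, h))) (at y)"
    by (auto intro!: derivative_eq_intros)
  from has_derivative_compose[OF this assms[unfolded gderiv_def]]
  show ?thesis
    by (simp add: gderiv_def inner_prod_def)
qed

text \<open>The form \<open>Suc k\<close> unfolds once, to continuity on the closure and a joint
  gradient on \<open>X \<times> Y\<close>. The conclusion must reach \<open>closure Y\<close>, as
  the supremum in \<open>b_utility\<close> ranges over it.\<close>

lemma grad_y_eq_imp_constant_diff:
  fixes b :: "'a::euclidean_space \<Rightarrow> 'b::euclidean_space \<Rightarrow> real"
  assumes C: "C_closure (Suc k) (X \<times> Y) (\<lambda>(x, y). b x y)"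
    and Y: "open Y" "connected Y"
    and x: "x0 \<in> X" "x1 \<in> X"
    and grad: "\<And>y. y \<in> Y \<Longrightarrow> grad_y b x0 y = grad_y b x1 y"
  obtains c where "\<And>y. y \<in> closure Y \<Longrightarrow> b x0 y = c + b x1 y"
proof -
  have cont_b: "continuous_on (closure Y) (b x)" if "x \<in> X" for x
  proof -
    have "continuous_on (closure X \<times> closure Y) (\<lambda>(x, y). b x y)"
      using C by (simp add: closure_Times)
    then have "continuous_on (closure Y) (\<lambda>y. case (x, y) of (x, y) \<Rightarrow> b x y)"
      by (rule continuous_on_compose2)
        (use that closure_subset in \<open>auto intro: continuous_on_Pair continuous_on_const continuous_on_id\<close>)
    then show ?thesis
      by simp
  qed
  have deriv_b: "(b x has_derivative (\<lambda>h. h \<bullet> grad_y b x y)) (at y)" if "x \<in> X" "y \<in> Y" for x y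
  proof -
    obtain G where "\<forall>z\<in>X \<times> Y. GDERIV (\<lambda>(x, y). b x y) z :> G z"
      using C unfolding C_closure.simps by blast
    then have "GDERIV (\<lambda>(x, y). b x y) (x, y) :> G (x, y)"
      using that by blast
    from GDERIV_grad_y[where b = b and x = x, OF GDERIV_Pair_right[OF this]] show ?thesis
      by (simp add: gderiv_def)
  qed
  have "((\<lambda>y. b x0 y - b x1 y) has_derivative (\<lambda>h. 0)) (at y)" if "y \<in> Y" for y
    using has_derivative_diff[OF deriv_b[OF x(1) that] deriv_b[OF x(2) that]] grad[OF that]
    by simp
  from has_derivative_zero_unique_connected[OF Y this]
  have "(\<lambda>y. b x0 y - b x1 y) constant_on Y"
    unfolding constant_on_def by metis
  then obtain c where "\<And>y. y \<in> Y \<Longrightarrow> b x0 y - b x1 y = c"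
    unfolding constant_on_def by auto
  from continuous_constant_on_closure[OF continuous_on_diff[OF cont_b[OF x(1)] cont_b[OF x(2)]] this]
  show thesis
    by (intro that[of c]) (simp add: diff_eq_eq)
qed

text \<open>As \<open>c\<close> and \<open>a\<close> are finite, an infinite \<open>v\<close> gives
  the same infinite value on both sides.\<close>

lemma ereal_add_diff_shift: "ereal (c + a) - v = ereal c + (ereal a - v)"
  by (cases v) auto

text \<open>A finite constant can be pulled out of a supremum over a nonempty set.\<close>

lemma b_utility_shift:
  assumes "\<And>y. y \<in> closure Y \<Longrightarrow> b x0 y = c + b x1 y" and "Y \<noteq> {}"
  shows "b_utility b Y v x0 = ereal c + b_utility b Y v x1"
proof -
  have "b_utility b Y v x0 = (SUP y\<in>closure Y. ereal c + (ereal (b x1 y) - v y))"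
    unfolding b_utility_def using assms(1) by (intro SUP_cong) (auto simp: ereal_add_diff_shift)
  also have "\<dots> = ereal c + b_utility b Y v x1"
    unfolding b_utility_def using \<open>Y \<noteq> {}\<close> by (intro SUP_ereal_add_right) auto
  finally show ?thesis .
qed

theorem lemma4p3:
  fixes X :: "(real ^ 'm) set" and Y :: "(real ^ 'n) set"
    and b :: "real ^ 'm \<Rightarrow> real ^ 'n \<Rightarrow> real"
    and L :: "real ^ 'm \<Rightarrow> (real ^ 'm) set"
  assumes "CARD('n) < CARD('m)"
    and "open X" and "bounded X"
    and "open Y" and "connected Y" and "Y \<noteq> {}" and "bounded Y"
    and "C_closure 4 (X \<times> Y) (\<lambda>(x, y). b x y)"
    and "\<And>x y. x \<in> X \<Longrightarrow> y \<in> Y \<Longrightarrow> connected (level_set b X x y)"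
    and "\<And>x y. x \<in> X \<Longrightarrow> y \<in> Y \<Longrightarrow> level_set b X x y = L x"
  shows "\<forall>x0\<in>X. \<forall>x1\<in>X. x0 \<in> L x1 \<longrightarrow>
    (\<forall>ybar\<in>Y. \<forall>v. price_schedule Y v \<longrightarrow> (\<forall>x\<in>X. \<bar>b_utility b Y v x\<bar> \<noteq> \<infinity>) \<longrightarrow>
      (b_utility b Y v x0 = ereal (b x0 ybar) - v ybar \<longleftrightarrow>
       b_utility b Y v x1 = ereal (b x1 ybar) - v ybar))"
proof (intro ballI impI allI)
  fix x0 x1 ybar v
  assume x: "x0 \<in> X" "x1 \<in> X" "x0 \<in> L x1" and ybar: "ybar \<in> Y"
  \<comment> \<open>Independence of \<open>y\<close> enters here: \<open>L x1\<close> is the level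
    set of \<open>x1\<close> at every \<open>y\<close> in \<open>Y\<close>, so the single membership
    of \<open>x0\<close> gives equal gradients throughout \<open>Y\<close>.\<close>
  have grad: "grad_y b x0 y = grad_y b x1 y" if "y \<in> Y" for y
    using x assms(10)[OF x(2) that] by (auto simp: level_set_def)
  have "C_closure (Suc 3) (X \<times> Y) (\<lambda>(x, y). b x y)"
    using assms(8) by (simp del: C_closure.simps)
  then obtain c where c: "\<And>y. y \<in> closure Y \<Longrightarrow> b x0 y = c + b x1 y"
    using grad_y_eq_imp_constant_diff[OF _ assms(4,5) x(1,2) grad] by blast
  have "b_utility b Y v x0 = ereal c + b_utility b Y v x1"
    using c \<open>Y \<noteq> {}\<close> by (rule b_utility_shift)
  moreover have "ereal (b x0 ybar) - v ybar = ereal c + (ereal (b x1 ybar) - v ybar)"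
    using c[OF subsetD[OF closure_subset ybar]] by (simp only: ereal_add_diff_shift)
  \<comment> \<open>Both sides of the first equation are those of the second plus
    \<open>ereal c\<close>, which cancels because it is finite, even if \<open>v ybar\<close> is
    infinite.\<close>
  ultimately show "b_utility b Y v x0 = ereal (b x0 ybar) - v ybar \<longleftrightarrow>
      b_utility b Y v x1 = ereal (b x1 ybar) - v ybar"
    by (simp add: ereal_add_cancel_left)
qed

end
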